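(* Let $q\in L^2([0,1],\mathbb{R})$ and let $\alpha,\beta,\gamma\in\mathbb{R}$ be three angles with $\sin(\beta-\gamma)\neq 0$. Let $g_{1,n}$ and $g_{2,n}$, $n\in\mathbb{N}_0$, denote the $L^2$-normalized eigenfunctions of the Sturm-Liouville equation $-u''+q(x)u=\lambda u$ on $[0,1]$ with boundary conditions $(\alpha\beta)$ and $(\alpha\gamma)$, respectively. Then the set of squared eigenfunctions $$\big\{\,g_{i,n}^2 \;\big|\; (i,n)\in\{1,2\}\times\mathbb{N}_0\,\big\}$$ is linearly independent in $H^1([0,1],\mathbb{R})$.
   Context: $\mathbb{N}_0=\{0,1,2,\dots\}$. The boundary conditions $(\alpha\beta)$ are $$u(0)\cos\alpha+u'(0)\sin\alpha=0,\qquad u(1)\cos\beta+u'(1)\sin\beta=0,$$ and $(\alpha\gamma)$ denotes the same conditions with $\beta$ replaced by $\gamma$. For each $i\in\{1,2\}$ the eigenvalues $\lambda_{i,n}$ are listed in increasing order, starting with $n=0$, and $g_{i,n}$ is the real eigenfunction for $\lambda_{i,n}$ with $\|g_{i,n}\|_{L^2}=1$ (unique up to sign). $H^1([0,1],\mathbb{R})$ is the Sobolev space with norm $\|f\|_{H^1}=\sqrt{\|f\|_{L^2}^2+\|f'\|_{L^2}^2}$, with distributional derivatives. *)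

theory Defs
  imports "HOL-Analysis.Analysis"
begin

text \<open>Functions on the unit interval are total functions \<^typ>\<open>real \<Rightarrow> real\<close>;
  their values outside \<open>{0..1}\<close> are never used.\<close>

abbreviation I01 :: "real measure"
  where "I01 \<equiv> lebesgue_on {0..1}"

definition L2 :: "(real \<Rightarrow> real) \<Rightarrow> bool"
  where "L2 f \<longleftrightarrow> f \<in> borel_measurable I01 \<and> integrable I01 (\<lambda>x. (f x)\<^sup>2)"

definition L2_norm :: "(real \<Rightarrow> real) \<Rightarrow> real"
  where "L2_norm f = sqrt (LINT x|I01. (f x)\<^sup>2)"

subsection \<open>The Sobolev space\<close>

text \<open>The space of smooth functions with compact support in the open unit interval.\<close>

definition test_fun :: "(real \<Rightarrow> real) \<Rightarrow> bool"
  where "test_fun \<phi> \<longleftrightarrow>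
    (\<forall>k. (deriv ^^ k) \<phi> differentiable_on UNIV) \<and>
    (\<exists>a b. 0 < a \<and> b < 1 \<and> (\<forall>x. \<phi> x \<noteq> 0 \<longrightarrow> x \<in> {a..b}))"

definition has_weak_deriv :: "(real \<Rightarrow> real) \<Rightarrow> (real \<Rightarrow> real) \<Rightarrow> bool"
  where "has_weak_deriv f h \<longleftrightarrow>
    (\<forall>\<phi>. test_fun \<phi> \<longrightarrow>
      (LINT x|I01. f x * deriv \<phi> x) = - (LINT x|I01. h x * \<phi> x))"

definition H1 :: "(real \<Rightarrow> real) \<Rightarrow> bool"
  where "H1 f \<longleftrightarrow> L2 f \<and> (\<exists>h. L2 h \<and> has_weak_deriv f h)"

definition H1_eq :: "(real \<Rightarrow> real) \<Rightarrow> (real \<Rightarrow> real) \<Rightarrow> bool"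
  where "H1_eq f g \<longleftrightarrow> H1 f \<and> H1 g \<and> (AE x in I01. f x = g x)"

lemma integrable_L2_mult_bounded:
  assumes "L2 f" and cont: "continuous_on UNIV \<psi>"
  shows "integrable I01 (\<lambda>x. f x * \<psi> x)"
proof -
  have fin: "finite_measure I01"
    by (rule finite_measure_lebesgue_on) auto
  have f: "integrable I01 f"
    using assms(1) finite_measure.square_integrable_imp_integrable[OF fin]
    unfolding L2_def by blast
  have "continuous_on {0..1} \<psi>"
    using cont continuous_on_subset by blast
  then have "bounded (\<psi> ` {0..1})"
    by (intro compact_imp_bounded compact_continuous_image) auto
  then obtain B where B: "\<And>x. x \<in> {0..1} \<Longrightarrow> \<bar>\<psi> x\<bar> \<le> B"
    unfolding bounded_iff by (metis imageI real_norm_def)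
  have m: "\<psi> \<in> borel_measurable I01"
    using \<open>continuous_on {0..1} \<psi>\<close>
    by (intro continuous_imp_measurable_on_sets_lebesgue) auto
  show ?thesis
  proof (rule Bochner_Integration.integrable_bound)
    show "integrable I01 (\<lambda>x. B * f x)"
      using f by simp
    show "(\<lambda>x. f x * \<psi> x) \<in> borel_measurable I01"
      using f m by measurable
    show "AE x in I01. norm (f x * \<psi> x) \<le> norm (B * f x)"
    proof (rule AE_I2)
      fix x assume "x \<in> space I01"
      then have "\<bar>\<psi> x\<bar> \<le> \<bar>B\<bar>" using B[of x] by (auto simp: space_restrict_space)
      then show "norm (f x * \<psi> x) \<le> norm (B * f x)"
        by (simp add: abs_mult mult.commute mult_right_mono)
    qed
  qed
qed

lemma test_fun_continuous:
  assumes "test_fun \<phi>"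
  shows "continuous_on UNIV \<phi>" "continuous_on UNIV (deriv \<phi>)"
proof -
  have d: "(deriv ^^ k) \<phi> differentiable_on UNIV" for k
    using assms unfolding test_fun_def by blast
  show "continuous_on UNIV \<phi>" "continuous_on UNIV (deriv \<phi>)"
    using d[of 0] d[of 1] by (auto intro: differentiable_imp_continuous_on)
qed

lemma L2_zero: "L2 (\<lambda>x. 0)"
  unfolding L2_def by simp

lemma L2_scale:
  assumes "L2 f"
  shows "L2 (\<lambda>x. c * f x)"
  using assms unfolding L2_def by (auto simp: power_mult_distrib)

lemma L2_add:
  assumes "L2 f" "L2 g"
  shows "L2 (\<lambda>x. f x + g x)"
  unfolding L2_def
proof (intro conjI)
  show m: "(\<lambda>x. f x + g x) \<in> borel_measurable I01"
    using assms unfolding L2_def by (auto intro: borel_measurable_add)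
  show "integrable I01 (\<lambda>x. (f x + g x)\<^sup>2)"
  proof (rule Bochner_Integration.integrable_bound)
    show "integrable I01 (\<lambda>x. 2 * (f x)\<^sup>2 + 2 * (g x)\<^sup>2)"
      using assms unfolding L2_def by auto
    show "(\<lambda>x. (f x + g x)\<^sup>2) \<in> borel_measurable I01"
      using m by measurable
    have "(f x + g x)\<^sup>2 \<le> 2 * (f x)\<^sup>2 + 2 * (g x)\<^sup>2" for x
      using zero_le_power2[of "f x - g x"] by (simp add: power2_eq_square algebra_simps)
    then show "AE x in I01. norm ((f x + g x)\<^sup>2) \<le> norm (2 * (f x)\<^sup>2 + 2 * (g x)\<^sup>2)"
      by simp
  qed
qed

lemma H1_zero: "H1 (\<lambda>x. 0)"
  unfolding H1_def has_weak_deriv_def using L2_zero by (auto intro!: exI[of _ "\<lambda>x. 0"])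

lemma H1_scale:
  assumes "H1 f"
  shows "H1 (\<lambda>x. c * f x)"
proof -
  obtain h where h: "L2 f" "L2 h" "has_weak_deriv f h"
    using assms unfolding H1_def by blast
  have "has_weak_deriv (\<lambda>x. c * f x) (\<lambda>x. c * h x)"
    using h(3) unfolding has_weak_deriv_def by (auto simp: mult.assoc)
  then show ?thesis
    using L2_scale h unfolding H1_def by blast
qed

lemma H1_add:
  assumes "H1 f" "H1 g"
  shows "H1 (\<lambda>x. f x + g x)"
proof -
  obtain h where h: "L2 f" "L2 h" "has_weak_deriv f h"
    using assms unfolding H1_def by blast
  obtain k where k: "L2 g" "L2 k" "has_weak_deriv g k"
    using assms unfolding H1_def by blast
  have "has_weak_deriv (\<lambda>x. f x + g x) (\<lambda>x. h x + k x)"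
    unfolding has_weak_deriv_def
  proof (intro allI impI)
    fix \<phi> assume \<phi>: "test_fun \<phi>"
    note i = integrable_L2_mult_bounded[OF _ test_fun_continuous(1)[OF \<phi>]]
      integrable_L2_mult_bounded[OF _ test_fun_continuous(2)[OF \<phi>]]
    show "(LINT x|I01. (f x + g x) * deriv \<phi> x) = - (LINT x|I01. (h x + k x) * \<phi> x)"
      using h k \<phi> i unfolding has_weak_deriv_def by (simp add: distrib_right)
  qed
  then show ?thesis
    using L2_add h k unfolding H1_def by blast
qed

text \<open>Elements of the Sobolev space are classes modulo equality almost everywhere.\<close>

quotient_type h1 = "real \<Rightarrow> real" / partial: H1_eq
  morphisms rep_h1 h1_class
proof (rule part_equivpI)
  show "\<exists>f. H1_eq f f"
    using H1_zero unfolding H1_eq_def by auto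
  show "symp H1_eq"
    unfolding symp_def H1_eq_def by (auto elim: eventually_mono)
  show "transp H1_eq"
    unfolding transp_def H1_eq_def by (auto elim: eventually_elim2)
qed

instantiation h1 :: real_vector
begin

lift_definition zero_h1 :: h1 is "\<lambda>x. 0"
  unfolding H1_eq_def using H1_zero by auto

lift_definition plus_h1 :: "h1 \<Rightarrow> h1 \<Rightarrow> h1" is "\<lambda>f g x. f x + g x"
  unfolding H1_eq_def by (auto intro: H1_add elim: eventually_elim2)

lift_definition scaleR_h1 :: "real \<Rightarrow> h1 \<Rightarrow> h1" is "\<lambda>c f x. c * f x"
  unfolding H1_eq_def by (auto intro: H1_scale elim: eventually_mono)

definition uminus_h1 :: "h1 \<Rightarrow> h1"
  where "uminus_h1 f = (-1) *\<^sub>R f"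

definition minus_h1 :: "h1 \<Rightarrow> h1 \<Rightarrow> h1"
  where "minus_h1 f g = f + (-1) *\<^sub>R g"

instance
proof
  fix a b c :: h1 and r s :: real
  show "a + b + c = a + (b + c)"
    by transfer (auto simp: H1_eq_def add.assoc intro!: H1_add)
  show "a + b = b + a"
    by transfer (auto simp: H1_eq_def add.commute intro!: H1_add)
  show "0 + a = a"
    by transfer (auto simp: H1_eq_def)
  show "- a + a = 0"
    unfolding uminus_h1_def
    by transfer (auto simp: H1_eq_def intro: H1_zero)
  show "a - b = a + - b"
    unfolding uminus_h1_def minus_h1_def ..
  show "r *\<^sub>R (a + b) = r *\<^sub>R a + r *\<^sub>R b"
    by transfer (auto simp: H1_eq_def distrib_left intro!: H1_add H1_scale)
  show "(r + s) *\<^sub>R a = r *\<^sub>R a + s *\<^sub>R a"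
    by transfer (auto simp: H1_eq_def distrib_right intro!: H1_add H1_scale)
  show "r *\<^sub>R s *\<^sub>R a = (r * s) *\<^sub>R a"
    by transfer (auto simp: H1_eq_def mult.assoc dest: H1_scale)
  show "1 *\<^sub>R a = a"
    by transfer (auto simp: H1_eq_def)
qed

end

subsection \<open>The Sturm--Liouville problem\<close>

text \<open>The usual epsilon-delta definition; \<^term>\<open>d\<close> is a finite family of
  non-overlapping compact intervals, and \<^term>\<open>Inf k\<close>, \<^term>\<open>Sup k\<close> are the
  endpoints of the interval \<^term>\<open>k\<close>.\<close>

definition abs_continuous01 :: "(real \<Rightarrow> real) \<Rightarrow> bool"
  where "abs_continuous01 f \<longleftrightarrow>
    (\<forall>\<epsilon>>0. \<exists>\<delta>>0. \<forall>d t. d division_of t \<and> t \<subseteq> {0..1} \<and> (\<Sum>k\<in>d. Sup k - Inf k) < \<delta> \<longrightarrow>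
      (\<Sum>k\<in>d. \<bar>f (Sup k) - f (Inf k)\<bar>) < \<epsilon>)"

text \<open>The derivative on the unit interval, one-sided at the endpoints.\<close>

definition D01 :: "(real \<Rightarrow> real) \<Rightarrow> real \<Rightarrow> real"
  where "D01 u x = vector_derivative u (at x within {0..1})"

text \<open>For a square integrable potential, a solution is a differentiable function
  with absolutely continuous derivative satisfying the equation almost everywhere.\<close>

definition SL_solution :: "(real \<Rightarrow> real) \<Rightarrow> real \<Rightarrow> (real \<Rightarrow> real) \<Rightarrow> bool"
  where "SL_solution q \<mu> u \<longleftrightarrow>
    u differentiable_on {0..1} \<and> abs_continuous01 (D01 u) \<and>
    (AE x in I01. D01 u differentiable (at x within {0..1}) \<and>
       - D01 (D01 u) x + q x * u x = \<mu> * u x)"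

definition SL_bc :: "real \<Rightarrow> real \<Rightarrow> (real \<Rightarrow> real) \<Rightarrow> bool"
  where "SL_bc \<alpha> \<beta> u \<longleftrightarrow>
    u 0 * cos \<alpha> + D01 u 0 * sin \<alpha> = 0 \<and> u 1 * cos \<beta> + D01 u 1 * sin \<beta> = 0"

definition SL_eigenfunction ::
    "(real \<Rightarrow> real) \<Rightarrow> real \<Rightarrow> real \<Rightarrow> real \<Rightarrow> (real \<Rightarrow> real) \<Rightarrow> bool"
  where "SL_eigenfunction q \<alpha> \<beta> \<mu> u \<longleftrightarrow>
    SL_solution q \<mu> u \<and> SL_bc \<alpha> \<beta> u \<and> (\<exists>x\<in>{0..1}. u x \<noteq> 0)"

text \<open>The problem is self-adjoint, so that only real eigenvalues need to be considered.\<close>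

definition SL_eigenvalues :: "(real \<Rightarrow> real) \<Rightarrow> real \<Rightarrow> real \<Rightarrow> real set"
  where "SL_eigenvalues q \<alpha> \<beta> = {\<mu>. \<exists>u. SL_eigenfunction q \<alpha> \<beta> \<mu> u}"

text \<open>The sequence \<^term>\<open>l\<close> lists all eigenvalues in increasing order (they are simple),
  and \<^term>\<open>g n\<close> is one of the two normalized eigenfunctions for \<^term>\<open>l n\<close>.\<close>

definition SL_eigensystem ::
    "(real \<Rightarrow> real) \<Rightarrow> real \<Rightarrow> real \<Rightarrow> (nat \<Rightarrow> real) \<Rightarrow> (nat \<Rightarrow> real \<Rightarrow> real) \<Rightarrow> bool"
  where "SL_eigensystem q \<alpha> \<beta> l g \<longleftrightarrow>
    strict_mono l \<and> range l = SL_eigenvalues q \<alpha> \<beta> \<and>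
    (\<forall>n. SL_eigenfunction q \<alpha> \<beta> (l n) (g n) \<and> L2_norm (g n) = 1)"

end

theory Submission
  imports Defs
begin

text \<open>The key is that the Wronskian \<open>W(u, v) = u v' - u' v\<close> of a solution \<open>u\<close> for the parameter \<open>\<nu>\<close>
and a solution \<open>v\<close> for \<open>\<mu>\<close> has the derivative \<open>(\<nu> - \<mu>) u v\<close>, so that
\<open>(W(u, v)\<^sup>2)' = (\<nu> - \<mu>) (u\<^sup>2 (v\<^sup>2)' - (u\<^sup>2)' v\<^sup>2)\<close>. Apart from the factor \<open>\<nu> - \<mu>\<close>, the right-hand
side is linear in \<open>u\<^sup>2\<close>. Hence a linear relation between the squares of finitely many solutions
\<open>u\<^sub>k\<close> for parameters \<open>\<nu>\<^sub>k\<close>, with coefficients \<open>c\<^sub>k\<close>, implies that the sum of the functions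
\<open>c\<^sub>k W(u\<^sub>k, v)\<^sup>2 / (\<nu>\<^sub>k - \<mu>)\<close> is constant, for every solution \<open>v\<close> whose parameter \<open>\<mu>\<close> is none of the \<open>\<nu>\<^sub>k\<close>.
If \<open>u\<^sub>k\<close> and \<open>v\<close> all satisfy the boundary condition for \<open>\<alpha>\<close> at \<open>0\<close>, the constant is zero
(\<open>wronskian_square_relation\<close>).

Now let the \<open>u\<^sub>k\<close> be eigenfunctions of the two problems and \<open>v\<close> an eigenfunction of the first one, for
one of the infinitely many eigenvalues \<open>\<mu>\<close> that do not occur in the relation. At the right
endpoint \<open>W(u\<^sub>k, v)\<close> vanishes if \<open>u\<^sub>k\<close> belongs to the first problem, and equals
\<open>A\<^sub>k B sin (\<beta> - \<gamma>)\<close> if it belongs to the second one; \<open>A\<^sub>k\<close> and \<open>B\<close> are nonzero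
because a solution with vanishing Cauchy data at \<open>1\<close> is zero (\<open>SL_solution_unique\<close>). So the rational
function with the simple poles \<open>\<nu>\<^sub>k\<close> and the coefficients \<open>c\<^sub>k A\<^sub>k\<^sup>2\<close>, where \<open>k\<close> ranges over the
second problem, has infinitely many zeros \<open>\<mu>\<close>, and all \<open>c\<^sub>k\<close> with \<open>k\<close> in the second problem vanish
(\<open>partial_fractions_zero\<close>, \<open>coefficients_of_one_problem_vanish\<close>). Exchanging \<open>\<beta>\<close> and \<open>\<gamma>\<close> gives the
remaining coefficients.

As the potential is only square integrable, the equation holds only almost everywhere. It is
used through the fundamental theorem of calculus for absolutely continuous functions
(\<open>abs_continuous01_FTC\<close>), which yields both the derivative of the Wronskian and the uniqueness.\<close>

section \<open>Absolutely continuous functions\<close>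

lemma abs_continuous01D:
  assumes "abs_continuous01 f" "0 < e"
  obtains \<delta> where "0 < \<delta>"
    "\<And>d t. d division_of t \<Longrightarrow> t \<subseteq> {0..1} \<Longrightarrow> (\<Sum>k\<in>d. Sup k - Inf k) < \<delta> \<Longrightarrow>
      (\<Sum>k\<in>d. \<bar>f (Sup k) - f (Inf k)\<bar>) < e"
  using assms unfolding abs_continuous01_def by meson

lemma division_of_real_interval:
  fixes t :: "real set"
  assumes "d division_of t" "t \<subseteq> {0..1}" "k \<in> d"
  obtains a b where "k = {a..b}" "0 \<le> a" "a \<le> b" "b \<le> 1"
proof -
  obtain a b where k: "k = {a..b}"
    using assms by (metis division_ofD(4) box_real(2))
  moreover have "k \<noteq> {}" "k \<subseteq> {0..1}"
    using assms by blast+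
  ultimately show ?thesis
    using that by auto
qed

text \<open>Sums, products, logarithms and \<open>C\<^sup>1\<close> functions are all absolutely continuous for the same reason:
their increments are controlled by those of functions already known to be absolutely continuous.\<close>

lemma abs_continuous01_comparison:
  assumes f: "abs_continuous01 f" and g: "abs_continuous01 g"
    and h: "\<And>x y. \<lbrakk>0 \<le> x; x \<le> y; y \<le> 1\<rbrakk> \<Longrightarrow>
      \<bar>h y - h x\<bar> \<le> C * (\<bar>f y - f x\<bar> + \<bar>g y - g x\<bar>)"
  shows "abs_continuous01 h"
  unfolding abs_continuous01_def
proof (intro allI impI)
  fix e :: real assume "0 < e"
  define C' where "C' = \<bar>C\<bar> + 1"
  have C': "0 < C'" "C \<le> C'"
    by (auto simp: C'_def)
  with \<open>0 < e\<close> have e: "0 < e / (2 * C')"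
    by simp
  obtain \<delta>1 where \<delta>1: "0 < \<delta>1" "\<And>d t. d division_of t \<Longrightarrow> t \<subseteq> {0..1} \<Longrightarrow>
      (\<Sum>k\<in>d. Sup k - Inf k) < \<delta>1 \<Longrightarrow> (\<Sum>k\<in>d. \<bar>f (Sup k) - f (Inf k)\<bar>) < e / (2 * C')"
    using abs_continuous01D[OF f e] by metis
  obtain \<delta>2 where \<delta>2: "0 < \<delta>2" "\<And>d t. d division_of t \<Longrightarrow> t \<subseteq> {0..1} \<Longrightarrow>
      (\<Sum>k\<in>d. Sup k - Inf k) < \<delta>2 \<Longrightarrow> (\<Sum>k\<in>d. \<bar>g (Sup k) - g (Inf k)\<bar>) < e / (2 * C')"
    using abs_continuous01D[OF g e] by metis
  have "(\<Sum>k\<in>d. \<bar>h (Sup k) - h (Inf k)\<bar>) < e"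
    if d: "d division_of t \<and> t \<subseteq> {0..1} \<and> (\<Sum>k\<in>d. Sup k - Inf k) < min \<delta>1 \<delta>2" for d t
  proof -
    have "\<bar>h (Sup k) - h (Inf k)\<bar>
        \<le> C' * (\<bar>f (Sup k) - f (Inf k)\<bar> + \<bar>g (Sup k) - g (Inf k)\<bar>)" if "k \<in> d" for k
    proof -
      obtain a b where k: "k = {a..b}" "0 \<le> a" "a \<le> b" "b \<le> 1"
        using division_of_real_interval d \<open>k \<in> d\<close> by metis
      have "\<bar>h b - h a\<bar> \<le> C * (\<bar>f b - f a\<bar> + \<bar>g b - g a\<bar>)"
        using h k by blast
      also have "\<dots> \<le> C' * (\<bar>f b - f a\<bar> + \<bar>g b - g a\<bar>)"
        using C' by (intro mult_right_mono) auto
      finally show ?thesis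
        using k by simp
    qed
    then have "(\<Sum>k\<in>d. \<bar>h (Sup k) - h (Inf k)\<bar>) \<le>
        (\<Sum>k\<in>d. C' * (\<bar>f (Sup k) - f (Inf k)\<bar> + \<bar>g (Sup k) - g (Inf k)\<bar>))"
      by (rule sum_mono)
    also have "\<dots> = C' * ((\<Sum>k\<in>d. \<bar>f (Sup k) - f (Inf k)\<bar>) + (\<Sum>k\<in>d. \<bar>g (Sup k) - g (Inf k)\<bar>))"
      by (simp add: sum_distrib_left sum.distrib distrib_left)
    also have "\<dots> < C' * (e / (2 * C') + e / (2 * C'))"
      using C' d \<delta>1(2)[of d t] \<delta>2(2)[of d t] by (intro mult_strict_left_mono add_strict_mono) auto
    also have "\<dots> = e"
      using C' by (simp add: field_simps)
    finally show ?thesis .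
  qed
  moreover have "0 < min \<delta>1 \<delta>2"
    using \<delta>1 \<delta>2 by simp
  ultimately show "\<exists>\<delta>>0. \<forall>d t. d division_of t \<and> t \<subseteq> {0..1} \<and> (\<Sum>k\<in>d. Sup k - Inf k) < \<delta> \<longrightarrow>
      (\<Sum>k\<in>d. \<bar>h (Sup k) - h (Inf k)\<bar>) < e"
    by blast
qed

lemma abs_continuous01_id: "abs_continuous01 (\<lambda>x. x)"
  unfolding abs_continuous01_def
proof (intro allI impI)
  fix e :: real assume e: "0 < e"
  have "(\<Sum>k\<in>d. \<bar>Sup k - Inf k\<bar>) = (\<Sum>k\<in>d. Sup k - Inf k)"
    if d: "d division_of t" "t \<subseteq> {0..1}" for d and t :: "real set"
  proof (intro sum.cong refl)
    fix k assume "k \<in> d"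
    then obtain a b where "k = {a..b}" "a \<le> b"
      using division_of_real_interval[OF d] by metis
    then show "\<bar>Sup k - Inf k\<bar> = Sup k - Inf k"
      by simp
  qed
  then show "\<exists>\<delta>>0. \<forall>d t. d division_of t \<and> t \<subseteq> {0..1} \<and> (\<Sum>k\<in>d. Sup k - Inf k) < \<delta> \<longrightarrow>
      (\<Sum>k\<in>d. \<bar>Sup k - Inf k\<bar>) < e"
    using e by (intro exI[of _ e]) auto
qed

lemma abs_continuous01_continuous:
  assumes f: "abs_continuous01 f"
  shows "continuous_on {0..1} f"
  unfolding continuous_on_iff
proof (intro ballI allI impI)
  fix x e :: real assume x: "x \<in> {0..1}" and e: "0 < e"
  obtain \<delta> where \<delta>: "0 < \<delta>" "\<And>d t. d division_of t \<Longrightarrow> t \<subseteq> {0..1} \<Longrightarrow>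
      (\<Sum>k\<in>d. Sup k - Inf k) < \<delta> \<Longrightarrow> (\<Sum>k\<in>d. \<bar>f (Sup k) - f (Inf k)\<bar>) < e"
    using abs_continuous01D[OF f e] by metis
  have *: "\<bar>f b - f a\<bar> < e" if "0 \<le> a" "a \<le> b" "b \<le> 1" "b - a < \<delta>" for a b
    using \<delta>(2)[of "{{a..b}}" "{a..b}"] that division_of_self[of a b] by auto
  have "dist (f y) (f x) < e" if "y \<in> {0..1}" "dist y x < \<delta>" for y
    using *[of x y] *[of y x] that x by (cases "x \<le> y") (auto simp: dist_real_def)
  then show "\<exists>d>0. \<forall>x'\<in>{0..1}. dist x' x < d \<longrightarrow> dist (f x') (f x) < e"
    using \<delta>(1) by blast
qed

lemma abs_continuous01_bounded:
  assumes "abs_continuous01 f"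
  obtains M where "0 \<le> M" "\<And>x. x \<in> {0..1} \<Longrightarrow> \<bar>f x\<bar> \<le> M"
proof -
  have "bounded (f ` {0..1})"
    using abs_continuous01_continuous[OF assms]
    by (intro compact_imp_bounded compact_continuous_image) auto
  then show ?thesis
    using that unfolding bounded_pos by (metis imageI less_imp_le real_norm_def)
qed

lemma abs_continuous01_add:
  assumes "abs_continuous01 f" "abs_continuous01 g"
  shows "abs_continuous01 (\<lambda>x. f x + g x)"
proof (rule abs_continuous01_comparison[OF assms])
  show "\<bar>f y + g y - (f x + g x)\<bar> \<le> 1 * (\<bar>f y - f x\<bar> + \<bar>g y - g x\<bar>)" for x y
    using abs_triangle_ineq[of "f y - f x" "g y - g x"] by (simp add: algebra_simps)
qed

lemma abs_continuous01_diff: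
  assumes "abs_continuous01 f" "abs_continuous01 g"
  shows "abs_continuous01 (\<lambda>x. f x - g x)"
proof (rule abs_continuous01_comparison[OF assms])
  show "\<bar>f y - g y - (f x - g x)\<bar> \<le> 1 * (\<bar>f y - f x\<bar> + \<bar>g y - g x\<bar>)" for x y
    using abs_triangle_ineq4[of "f y - f x" "g y - g x"] by (simp add: algebra_simps)
qed

lemma abs_continuous01_mult:
  assumes f: "abs_continuous01 f" and g: "abs_continuous01 g"
  shows "abs_continuous01 (\<lambda>x. f x * g x)"
proof -
  obtain M where M: "0 \<le> M" "\<And>x. x \<in> {0..1} \<Longrightarrow> \<bar>f x\<bar> \<le> M"
    using abs_continuous01_bounded[OF f] by metis
  obtain L where L: "0 \<le> L" "\<And>x. x \<in> {0..1} \<Longrightarrow> \<bar>g x\<bar> \<le> L"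
    using abs_continuous01_bounded[OF g] by metis
  show ?thesis
  proof (rule abs_continuous01_comparison[OF f g])
    fix x y :: real assume xy: "0 \<le> x" "x \<le> y" "y \<le> 1"
    have "f y * g y - f x * g x = g y * (f y - f x) + f x * (g y - g x)"
      by (simp add: algebra_simps)
    also have "\<bar>\<dots>\<bar> \<le> \<bar>g y\<bar> * \<bar>f y - f x\<bar> + \<bar>f x\<bar> * \<bar>g y - g x\<bar>"
      by (metis abs_mult abs_triangle_ineq)
    also have "\<dots> \<le> (M + L) * \<bar>f y - f x\<bar> + (M + L) * \<bar>g y - g x\<bar>"
      using M(1) M(2)[of x] L(1) L(2)[of y] xy by (intro add_mono mult_right_mono) auto
    finally show "\<bar>f y * g y - f x * g x\<bar> \<le> (M + L) * (\<bar>f y - f x\<bar> + \<bar>g y - g x\<bar>)"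
      by (simp add: distrib_left)
  qed
qed

lemma abs_continuous01_C1:
  assumes f: "\<And>x. x \<in> {0..1} \<Longrightarrow> (f has_real_derivative f' x) (at x within {0..1})"
    and f': "continuous_on {0..1} f'"
  shows "abs_continuous01 f"
proof -
  have "bounded (f' ` {0..1})"
    using f' by (intro compact_imp_bounded compact_continuous_image) auto
  then obtain M where M: "\<And>x. x \<in> {0..1} \<Longrightarrow> \<bar>f' x\<bar> \<le> M"
    unfolding bounded_iff by (metis imageI real_norm_def)
  show ?thesis
  proof (rule abs_continuous01_comparison[OF abs_continuous01_id abs_continuous01_id])
    fix x y :: real assume "0 \<le> x" "x \<le> y" "y \<le> 1"
    then have "norm (f y - f x) \<le> M * norm (y - x)"
      using M by (intro field_differentiable_bound[of "{0..1}" f f']) (auto intro: f)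
    also have "\<dots> \<le> M * (\<bar>y - x\<bar> + \<bar>y - x\<bar>)"
      using M[of 0] by (intro mult_left_mono) auto
    finally show "\<bar>f y - f x\<bar> \<le> M * (\<bar>y - x\<bar> + \<bar>y - x\<bar>)"
      by simp
  qed
qed

lemma abs_continuous01_ln:
  assumes f: "abs_continuous01 f" and "0 < m" and m: "\<And>x. x \<in> {0..1} \<Longrightarrow> m \<le> f x"
  shows "abs_continuous01 (\<lambda>x. ln (f x))"
proof (rule abs_continuous01_comparison[OF f f])
  fix x y :: real assume xy: "0 \<le> x" "x \<le> y" "y \<le> 1"
  have "\<bar>ln b - ln a\<bar> \<le> 1 / m * (b - a)" if "m \<le> a" "a \<le> b" for a b :: real
  proof -
    have "ln b - ln a = ln (b / a)"
      using that \<open>0 < m\<close> by (simp add: ln_div)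
    also have "\<dots> \<le> b / a - 1"
      using that \<open>0 < m\<close> by (intro ln_le_minus_one) auto
    also have "\<dots> = (b - a) / a"
      using that \<open>0 < m\<close> by (simp add: field_simps)
    also have "\<dots> \<le> (b - a) / m"
      using that \<open>0 < m\<close> by (intro divide_left_mono) auto
    finally show ?thesis
      using that \<open>0 < m\<close> by simp
  qed
  from this[of "f x" "f y"] this[of "f y" "f x"]
  have "\<bar>ln (f y) - ln (f x)\<bar> \<le> 1 / m * \<bar>f y - f x\<bar>"
    using m[of x] m[of y] xy by (cases "f x \<le> f y") (auto simp: abs_minus_commute)
  also have "\<dots> \<le> 1 / m * (\<bar>f y - f x\<bar> + \<bar>f y - f x\<bar>)"
    using \<open>0 < m\<close> by (intro mult_left_mono) auto
  finally show "\<bar>ln (f y) - ln (f x)\<bar> \<le> 1 / m * (\<bar>f y - f x\<bar> + \<bar>f y - f x\<bar>)" .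
qed

section \<open>The fundamental theorem of calculus\<close>

lemma sum_content_division_le_measure:
  fixes t :: "real set"
  assumes d: "d division_of t" and t: "t \<subseteq> U" and U: "U \<in> lmeasurable"
  shows "(\<Sum>k\<in>d. Sup k - Inf k) \<le> measure lebesgue U"
proof -
  have k: "\<exists>a b. k = {a..b} \<and> a \<le> b" if "k \<in> d" for k
    using division_ofD(3,4)[OF d that] by auto
  have "(\<Sum>k\<in>d. Sup k - Inf k) = (\<Sum>k\<in>d. measure lebesgue k)"
  proof (intro sum.cong refl)
    fix k' assume "k' \<in> d"
    then obtain a b where "k' = {a..b}" "a \<le> b"
      using k by blast
    then show "Sup k' - Inf k' = measure lebesgue k'"
      by simp
  qed
  also have "\<dots> = measure lebesgue (\<Union>d)"
  proof (rule measure_negligible_finite_Union[symmetric])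
    show "finite d"
      using d by blast
    show "k \<in> lmeasurable" if "k \<in> d" for k
      using k[OF that] by auto
    show "pairwise (\<lambda>S T. negligible (S \<inter> T)) d"
    proof (rule pairwiseI)
      fix S T assume ST: "S \<in> d" "T \<in> d" "S \<noteq> T"
      then have "interior (S \<inter> T) = {}"
        using division_ofD(5)[OF d] by simp
      moreover have "convex (S \<inter> T)"
        using k ST by (metis convex_Int convex_real_interval(5))
      ultimately show "negligible (S \<inter> T)"
        using negligible_convex_interior by blast
    qed
  qed
  also have "\<dots> \<le> measure lebesgue U"
  proof (rule measure_mono_fmeasurable)
    show "\<Union>d \<subseteq> U" 
      using d t by blast
    show "\<Union>d \<in> sets lebesgue"
      using d k by (metis division_of_def fmeasurableD lmeasurable_division)
  qed (rule U)
  finally show ?thesis .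
qed

text \<open>The integral is the gauge integral, for which the proof is direct. At a point where the derivative
exists, a fine interval contributes an error of at most a small multiple of its length. The
intervals with a tag in the exceptional set \<open>N\<close> lie in an open set of small measure, so the total
increment of \<open>f\<close> over them is small by absolute continuity.\<close>

lemma abs_continuous01_FTC:
  assumes f: "abs_continuous01 f" and ab: "0 \<le> a" "a \<le> b" "b \<le> 1"
    and N: "negligible N"
    and deriv: "\<And>x. x \<in> {a..b} - N \<Longrightarrow> (f has_real_derivative f' x) (at x within {a..b})"
  shows "(f' has_integral f b - f a) {a..b}"
proof -
  define h where "h x = (if x \<in> N then 0 else f' x)" for x
  have "(h has_integral f b - f a) {a..b}"
    unfolding has_integral_real
  proof (intro allI impI)
    fix e :: real assume "0 < e"
    \<comment> \<open>Half of the admissible error goes to each of the two kinds of intervals; the summand \<open>1\<close>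
      covers the case \<open>a = b\<close>.\<close>
    define c where "c = e / (2 * (b - a + 1))"
    have c: "0 < c" "c * (b - a) < e / 2"
      using \<open>0 < e\<close> ab by (auto simp: c_def field_simps)
    obtain \<delta> where \<delta>: "0 < \<delta>" "\<And>d t. d division_of t \<Longrightarrow> t \<subseteq> {0..1} \<Longrightarrow>
      (\<Sum>k\<in>d. Sup k - Inf k) < \<delta> \<Longrightarrow> (\<Sum>k\<in>d. \<bar>f (Sup k) - f (Inf k)\<bar>) < e / 2"
      using abs_continuous01D[OF f half_gt_zero[OF \<open>0 < e\<close>]] by metis
    obtain U where U: "open U" "N \<subseteq> U" "U - N \<in> lmeasurable" "emeasure lebesgue (U - N) < ennreal \<delta>"
      using sets_lebesgue_outer_open[OF negligible_imp_sets[OF N] \<delta>(1)] by metis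
    have "(U - N) \<union> N = U"
      using U(2) by blast
    then have Um: "U \<in> lmeasurable"
      using U(3) negligible_imp_measurable[OF N] by (metis fmeasurable.Un)
    have "measure lebesgue U \<le> measure lebesgue (U - N) + measure lebesgue N"
      using measure_Un_le[of "U - N" lebesgue N] U(3) negligible_imp_sets[OF N] \<open>(U - N) \<union> N = U\<close>
      by (simp add: fmeasurableD)
    also have "\<dots> < \<delta>"
      using U(3,4) \<delta>(1) negligible_imp_measure0[OF N]
      by (simp add: emeasure_eq_measure2 ennreal_less_iff)
    finally have U\<delta>: "measure lebesgue U < \<delta>" .
    have "\<exists>r>0. (x \<in> N \<longrightarrow> ball x r \<subseteq> U) \<and> (x \<in> {a..b} - N \<longrightarrow>
        (\<forall>y\<in>{a..b}. \<bar>y - x\<bar> < r \<longrightarrow> \<bar>f y - f x - (y - x) * f' x\<bar> \<le> c * \<bar>y - x\<bar>))" for x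
    proof (cases "x \<in> N")
      case True
      then obtain r where "0 < r" "ball x r \<subseteq> U"
        using U(1,2) open_contains_ball by blast
      with True show ?thesis
        by auto
    next
      case False
      show ?thesis
      proof (cases "x \<in> {a..b}")
        case True
        then have "(f has_derivative (\<lambda>h. h * f' x)) (at x within {a..b})"
          using deriv[of x] False by (simp add: has_field_derivative_def mult_commute_abs)
        then obtain r where "0 < r"
          "\<forall>y\<in>{a..b}. norm (y - x) < r \<longrightarrow> norm (f y - f x - (y - x) * f' x) \<le> c * norm (y - x)"
          using c(1) unfolding has_derivative_within_alt by blast
        then show ?thesis
          using False by (intro exI[of _ r]) auto
      qed (use False in \<open>auto intro: exI[of _ 1]\<close>)
    qed
    then have "\<exists>r. \<forall>x. 0 < r x \<and> (x \<in> N \<longrightarrow> ball x (r x) \<subseteq> U) \<and> (x \<in> {a..b} - N \<longrightarrow>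
        (\<forall>y\<in>{a..b}. \<bar>y - x\<bar> < r x \<longrightarrow> \<bar>f y - f x - (y - x) * f' x\<bar> \<le> c * \<bar>y - x\<bar>))"
      by (intro choice allI) simp
    then obtain r where r: "\<And>x. 0 < r x" "\<And>x. x \<in> N \<Longrightarrow> ball x (r x) \<subseteq> U"
      "\<And>x y. \<lbrakk>x \<in> {a..b} - N; y \<in> {a..b}; \<bar>y - x\<bar> < r x\<rbrakk> \<Longrightarrow>
        \<bar>f y - f x - (y - x) * f' x\<bar> \<le> c * \<bar>y - x\<bar>"
      by blast
    show "\<exists>\<gamma>. gauge \<gamma> \<and> (\<forall>p. p tagged_division_of {a..b} \<and> \<gamma> fine p \<longrightarrow>
        norm ((\<Sum>(x, k)\<in>p. measure lborel k *\<^sub>R h x) - (f b - f a)) < e)"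
    proof (intro exI conjI allI impI)
      show "gauge (\<lambda>x. ball x (r x))"
        using r(1) gauge_ball_dependent by blast
      fix p assume p: "p tagged_division_of {a..b} \<and> (\<lambda>x. ball x (r x)) fine p"
      then have ptag: "p tagged_division_of {a..b}" and fine: "(\<lambda>x. ball x (r x)) fine p"
        by auto
      have fin: "finite p"
        using ptag by blast
      have pk: "\<exists>u v. K = {u..v} \<and> a \<le> u \<and> u \<le> x \<and> x \<le> v \<and> v \<le> b \<and> K \<subseteq> ball x (r x)"
        if xK: "(x, K) \<in> p" for x K
      proof -
        obtain u v where "K = {u..v}"
          using tagged_division_ofD(4)[OF ptag xK] by auto
        moreover have "x \<in> K" "K \<subseteq> {a..b}" "K \<subseteq> ball x (r x)"
          using ptag fine xK by (blast dest: fineD)+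
        ultimately show ?thesis
          by auto
      qed
      define F where "F = (\<lambda>(x, K). measure lborel K *\<^sub>R h x - (f (Sup K) - f (Inf K)))"
      \<comment> \<open>the intervals tagged in the exceptional set\<close>
      define B where "B = {(x, K) \<in> p. x \<in> N}"
      have "(\<Sum>(x, k)\<in>p. measure lborel k *\<^sub>R h x) - (f b - f a) = sum F p"
        using additive_tagged_division_1[OF ab(2) ptag, of f]
        by (simp add: F_def sum_subtractf split_def)
      also have "\<dots> = sum F (p - B) + sum F B"
        by (rule sum.subset_diff) (auto simp: B_def fin)
      finally have split: "norm ((\<Sum>(x, k)\<in>p. measure lborel k *\<^sub>R h x) - (f b - f a))
          \<le> norm (sum F (p - B)) + norm (sum F B)"
        by (metis norm_triangle_ineq)
      have "norm (sum F (p - B)) \<le> (\<Sum>(x, K)\<in>p - B. c * (Sup K - Inf K))"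
      proof (rule sum_norm_le, clarify)
        fix x K assume xK: "(x, K) \<in> p" "(x, K) \<notin> B"
        obtain u v where K: "K = {u..v}" "a \<le> u" "u \<le> x" "x \<le> v" "v \<le> b" "K \<subseteq> ball x (r x)"
          using pk[OF xK(1)] by blast
        have x: "x \<in> {a..b} - N"
          using xK K by (auto simp: B_def)
        have "u \<in> {u..v}" "v \<in> {u..v}"
          using K by auto
        then have "u \<in> ball x (r x)" "v \<in> ball x (r x)"
          using K(1,6) by blast+
        then have "\<bar>f u - f x - (u - x) * f' x\<bar> \<le> c * \<bar>u - x\<bar>" "\<bar>f v - f x - (v - x) * f' x\<bar> \<le> c * \<bar>v - x\<bar>"
          using r(3)[OF x, of u] r(3)[OF x, of v] K(2-5) by (simp_all add: dist_real_def abs_minus_commute)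
        moreover have "F (x, K) = (f u - f x - (u - x) * f' x) - (f v - f x - (v - x) * f' x)"
          using x K by (simp add: F_def h_def algebra_simps)
        ultimately have "\<bar>F (x, K)\<bar> \<le> c * \<bar>u - x\<bar> + c * \<bar>v - x\<bar>"
          by linarith
        also have "\<dots> = c * (Sup K - Inf K)"
          using K by (simp add: algebra_simps)
        finally show "norm (F (x, K)) \<le> c * (Sup K - Inf K)"
          by simp
      qed
      also have "\<dots> \<le> (\<Sum>(x, K)\<in>p. c * (Sup K - Inf K))"
      proof (rule sum_mono2[OF fin])
        show "0 \<le> (case z of (x, K) \<Rightarrow> c * (Sup K - Inf K))" if z: "z \<in> p - (p - B)" for z
        proof -
          obtain x K where xK: "z = (x, K)" "(x, K) \<in> p"
            using z by (cases z) auto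
          obtain u v where K: "K = {u..v}" "u \<le> x" "x \<le> v"
            using pk[OF xK(2)] by blast
          then have "u \<le> v"
            by linarith
          then show ?thesis
            using c(1) xK K by simp
        qed
      qed blast
      also have "\<dots> = c * (b - a)"
        using additive_tagged_division_1[OF ab(2) ptag, of "\<lambda>x. x"]
        by (simp add: sum_distrib_left[symmetric] split_def)
      finally have good: "norm (sum F (p - B)) < e / 2"
        using c(2) by linarith
      have B: "B tagged_division_of \<Union>(snd ` B)"
      proof (rule tagged_partial_division_of_Union_self[OF tagged_partial_division_subset])
        show "p tagged_partial_division_of {a..b}"
          using ptag unfolding tagged_division_of_def by blast
        show "B \<subseteq> p"
          unfolding B_def by blast
      qed
      then have div: "snd ` B division_of \<Union>(snd ` B)"
        by (rule division_of_tagged_division)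
      have B': "K \<subseteq> {0..1} \<and> K \<subseteq> U" if "(x, K) \<in> B" for x K
      proof -
        have "(x, K) \<in> p" "x \<in> N"
          using that by (auto simp: B_def)
        then show ?thesis
          using pk[of x K] r(2)[of x] ab by auto
      qed
      then have sub01: "\<Union>(snd ` B) \<subseteq> {0..1}" and subU: "\<Union>(snd ` B) \<subseteq> U"
        by fastforce+
      \<comment> \<open>The empty set needs the value \<open>0\<close> for the passage from tagged to untagged intervals.\<close>
      define G where "G K = (if K = {} then 0 else \<bar>f (Sup K) - f (Inf K)\<bar>)" for K :: "real set"
      have "norm (sum F B) \<le> (\<Sum>(x, K)\<in>B. G K)"
      proof (rule sum_norm_le, clarify)
        fix x K assume xK: "(x, K) \<in> B"
        then have "x \<in> N" "(x, K) \<in> p"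
          by (auto simp: B_def)
        moreover have "K \<noteq> {}"
          using pk[OF \<open>(x, K) \<in> p\<close>] by auto
        ultimately show "norm (F (x, K)) \<le> G K"
          by (simp add: F_def G_def h_def)
      qed
      also have "\<dots> = sum G (snd ` B)"
        using B by (rule sum.over_tagged_division_lemma) (auto simp: G_def)
      also have "\<dots> = (\<Sum>K\<in>snd ` B. \<bar>f (Sup K) - f (Inf K)\<bar>)"
        using division_ofD(3)[OF div] by (intro sum.cong) (auto simp: G_def)
      also have "\<dots> < e / 2"
        using \<delta>(2)[OF div sub01] sum_content_division_le_measure[OF div subU Um] U\<delta> by linarith
      finally show "norm ((\<Sum>(x, k)\<in>p. measure lborel k *\<^sub>R h x) - (f b - f a)) < e"
        using split good by linarith
    qed
  qed
  then show ?thesis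
    by (rule has_integral_spike[OF N, rotated]) (simp add: h_def)
qed

section \<open>Solutions of the Sturm-Liouville equation\<close>

lemma AE_I01_negligible:
  "(AE x in I01. P x) \<longleftrightarrow> (\<exists>N. negligible N \<and> (\<forall>x\<in>{0..1} - N. P x))"
proof -
  have "(AE x in I01. P x) \<longleftrightarrow> (AE x in lebesgue. x \<in> {0..1} \<longrightarrow> P x)"
    by (rule AE_restrict_space_iff) simp
  also have "\<dots> \<longleftrightarrow> (\<exists>N. negligible N \<and> (\<forall>x\<in>{0..1} - N. P x))"
    unfolding eventually_ae_filter_negligible by (intro arg_cong[where f = Ex] ext) blast
  finally show ?thesis .
qed

context
  fixes q \<mu> u
  assumes u: "SL_solution q \<mu> u"
begin

lemma SL_solution_deriv:
  assumes "x \<in> {0..1}"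
  shows "(u has_real_derivative D01 u x) (at x within {0..1})"
  using u assms unfolding SL_solution_def differentiable_on_def D01_def
  by (metis vector_derivative_works has_real_derivative_iff_has_vector_derivative)

lemma SL_solution_abs_continuous_deriv: "abs_continuous01 (D01 u)"
  using u unfolding SL_solution_def by blast

lemma SL_solution_abs_continuous: "abs_continuous01 u"
  using abs_continuous01_C1 SL_solution_deriv
    abs_continuous01_continuous[OF SL_solution_abs_continuous_deriv] by blast

lemma SL_solution_deriv2:
  obtains N where "negligible N"
    "\<And>x. x \<in> {0..1} - N \<Longrightarrow> (D01 u has_real_derivative (q x - \<mu>) * u x) (at x within {0..1})"
proof -
  obtain N where N: "negligible N" "\<forall>x\<in>{0..1} - N. D01 u differentiable (at x within {0..1}) \<and>
       - D01 (D01 u) x + q x * u x = \<mu> * u x"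
    using u unfolding SL_solution_def AE_I01_negligible by blast
  have "(D01 u has_real_derivative (q x - \<mu>) * u x) (at x within {0..1})" if "x \<in> {0..1} - N" for x
  proof -
    have "(D01 u has_vector_derivative D01 (D01 u) x) (at x within {0..1})"
      using N(2) that unfolding D01_def[of "D01 u"] vector_derivative_works by blast
    moreover have "D01 (D01 u) x = (q x - \<mu>) * u x"
      using N(2) that by (auto simp: algebra_simps)
    ultimately show ?thesis
      by (simp add: has_real_derivative_iff_has_vector_derivative)
  qed
  then show ?thesis
    using N(1) that by blast
qed

end

definition wronskian :: "(real \<Rightarrow> real) \<Rightarrow> (real \<Rightarrow> real) \<Rightarrow> real \<Rightarrow> real"
  where "wronskian u v x = u x * D01 v x - D01 u x * v x"

text \<open>At first the derivative is known only where both equations hold, but the Wronskian is absolutely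
continuous and the almost everywhere derivative is a continuous function. Hence the Wronskian is
the integral of that function and the formula holds at every point.\<close>

lemma wronskian_deriv:
  assumes u: "SL_solution q \<nu> u" and v: "SL_solution q \<mu> v" and x: "x \<in> {0..1}"
  shows "(wronskian u v has_real_derivative (\<nu> - \<mu>) * (u x * v x)) (at x within {0..1})"
proof -
  obtain N where N: "negligible N" "\<And>x. x \<in> {0..1} - N \<Longrightarrow>
      (D01 u has_real_derivative (q x - \<nu>) * u x) (at x within {0..1})"
    using SL_solution_deriv2[OF u] by metis
  obtain N' where N': "negligible N'" "\<And>x. x \<in> {0..1} - N' \<Longrightarrow>
      (D01 v has_real_derivative (q x - \<mu>) * v x) (at x within {0..1})"
    using SL_solution_deriv2[OF v] by metis
  let ?h = "\<lambda>x. (\<nu> - \<mu>) * (u x * v x)"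
  have W: "abs_continuous01 (wronskian u v)"
    unfolding wronskian_def[abs_def]
    using SL_solution_abs_continuous[OF u] SL_solution_abs_continuous[OF v]
      SL_solution_abs_continuous_deriv[OF u] SL_solution_abs_continuous_deriv[OF v]
    by (intro abs_continuous01_diff abs_continuous01_mult)
  have ae: "(wronskian u v has_real_derivative ?h y) (at y within {0..1})"
    if y: "y \<in> {0..1} - (N \<union> N')" for y
  proof -
    have "(wronskian u v has_real_derivative
        (D01 u y * D01 v y + (q y - \<mu>) * v y * u y)
        - ((q y - \<nu>) * u y * v y + D01 v y * D01 u y)) (at y within {0..1})"
      unfolding wronskian_def[abs_def]
      using y by (intro DERIV_diff DERIV_mult SL_solution_deriv[OF u] SL_solution_deriv[OF v] N(2) N'(2)) auto
    then show ?thesis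
      by (simp add: algebra_simps)
  qed
  have int: "(?h has_integral wronskian u v y - wronskian u v 0) {0..y}" if "y \<in> {0..1}" for y
  proof (rule abs_continuous01_FTC[OF W])
    show "negligible (N \<union> N')"
      using N(1) N'(1) by simp
    show "(wronskian u v has_real_derivative ?h z) (at z within {0..y})"
      if "z \<in> {0..y} - (N \<union> N')" for z
      by (rule DERIV_subset[OF ae]) (use that \<open>y \<in> {0..1}\<close> in auto)
  qed (use that in auto)
  have "continuous_on {0..1} ?h"
    using abs_continuous01_continuous[OF SL_solution_abs_continuous[OF u]]
      abs_continuous01_continuous[OF SL_solution_abs_continuous[OF v]]
    by (intro continuous_intros)
  then have "((\<lambda>y. wronskian u v 0 + integral {0..y} ?h) has_real_derivative 0 + ?h x) (at x within {0..1})"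
    by (intro DERIV_add DERIV_const integral_has_real_derivative x)
  then show ?thesis
  proof (rule has_field_derivative_transform_within[where d = 1, OF _ _ x, THEN DERIV_cong])
    show "wronskian u v 0 + integral {0..y} ?h = wronskian u v y" if "y \<in> {0..1}" for y
      using integral_unique[OF int[OF that]] by simp
  qed auto
qed

text \<open>Let \<open>E = u\<^sup>2 + u'\<^sup>2\<close>. Then \<open>E' = 2 u u' (1 + q - \<mu>)\<close> almost everywhere, and \<open>\<bar>2 u u'\<bar> \<le> E\<close>. For
every \<open>\<epsilon> > 0\<close> the derivative of \<open>ln (E + \<epsilon>)\<close> is therefore bounded by the integrable function
\<open>1 + \<bar>q - \<mu>\<bar>\<close>, uniformly in \<open>\<epsilon>\<close>. Integrating from \<open>x\<close> to \<open>1\<close>, where \<open>E\<close> vanishes, bounds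
\<open>E x + \<epsilon>\<close> by a constant times \<open>\<epsilon>\<close>.\<close>

lemma SL_solution_unique:
  assumes q: "L2 q" and u: "SL_solution q \<mu> u" and u1: "u 1 = 0" "D01 u 1 = 0"
    and x: "x \<in> {0..1}"
  shows "u x = 0"
proof -
  define k where "k x = 1 + \<bar>q x - \<mu>\<bar>" for x
  define E where "E x = u x * u x + D01 u x * D01 u x" for x
  have "integrable I01 q"
    using q finite_measure.square_integrable_imp_integrable[OF finite_measure_lebesgue_on[of "{0..1}"]]
    unfolding L2_def by auto
  then have "integrable I01 k"
    unfolding k_def[abs_def]
    by (intro Bochner_Integration.integrable_add Bochner_Integration.integrable_abs
        Bochner_Integration.integrable_diff finite_measure.integrable_const finite_measure_lebesgue_on) auto
  then have "k integrable_on {0..1}"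
    by (intro integrable_on_lebesgue_on) auto
  then have k: "k integrable_on {x..1}"
    by (rule integrable_on_subinterval) (use x in auto)
  obtain N where N: "negligible N" "\<And>x. x \<in> {0..1} - N \<Longrightarrow>
      (D01 u has_real_derivative (q x - \<mu>) * u x) (at x within {0..1})"
    using SL_solution_deriv2[OF u] by metis
  have E0: "0 \<le> E y" for y
    by (simp add: E_def)
  have E: "abs_continuous01 E"
    unfolding E_def[abs_def]
    using SL_solution_abs_continuous[OF u] SL_solution_abs_continuous_deriv[OF u]
    by (intro abs_continuous01_add abs_continuous01_mult)
  have le: "E x + \<epsilon> \<le> \<epsilon> * exp (integral {x..1} k)" if "0 < \<epsilon>" for \<epsilon>
  proof -
    let ?L = "\<lambda>y. ln (E y + \<epsilon>)"
    let ?L' = "\<lambda>y. inverse (E y + \<epsilon>) * (2 * u y * D01 u y * (1 + (q y - \<mu>)))"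
    have pos: "0 < E y + \<epsilon>" for y
      using E0[of y] that by linarith
    have L: "abs_continuous01 ?L"
      using that E0 abs_continuous01_C1[of "\<lambda>_. \<epsilon>" "\<lambda>_. 0"]
      by (intro abs_continuous01_ln[where m = \<epsilon>] abs_continuous01_add E) auto
    have "(?L' has_integral ?L 1 - ?L x) {x..1}"
    proof (rule abs_continuous01_FTC[OF L _ _ _ N(1)])
      fix y assume y: "y \<in> {x..1} - N"
      then have "(?L has_real_derivative inverse (E y + \<epsilon>) * ((D01 u y * u y + D01 u y * u y
          + ((q y - \<mu>) * u y * D01 u y + (q y - \<mu>) * u y * D01 u y)) + 0)) (at y within {0..1})"
        unfolding E_def
        using pos[of y] x
        by (intro DERIV_chain2[of ln] DERIV_ln DERIV_add DERIV_const DERIV_mult SL_solution_deriv[OF u] N(2))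
          (auto simp: E_def)
      then show "(?L has_real_derivative ?L' y) (at y within {x..1})"
        by (rule DERIV_subset[THEN DERIV_cong]) (use x in \<open>auto simp: algebra_simps\<close>)
    qed (use x in auto)
    moreover have "norm (?L' y) \<le> k y" for y
    proof -
      have "2 * \<bar>u y * D01 u y\<bar> \<le> E y"
        using sum_squares_bound[of "\<bar>u y\<bar>" "\<bar>D01 u y\<bar>"]
        by (simp add: E_def power2_eq_square abs_mult)
      also have "\<dots> \<le> E y + \<epsilon>"
        using that by simp
      finally have "2 * \<bar>u y * D01 u y\<bar> * \<bar>1 + (q y - \<mu>)\<bar> \<le> (E y + \<epsilon>) * k y"
        unfolding k_def using pos[of y] by (intro mult_mono) auto
      moreover have "norm (?L' y) = 2 * \<bar>u y * D01 u y\<bar> * \<bar>1 + (q y - \<mu>)\<bar> / (E y + \<epsilon>)"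
        using pos[of y] by (simp add: abs_mult divide_inverse_commute)
      ultimately show ?thesis
        using pos[of y] by (simp add: divide_le_eq mult.commute)
    qed
    ultimately have "norm (?L 1 - ?L x) \<le> integral {x..1} k"
      using integral_norm_bound_integral[of ?L' "{x..1}" k] k by (auto simp: integral_unique has_integral_integrable)
    moreover have "E 1 = 0"
      by (simp add: E_def u1)
    ultimately have "?L x \<le> ln \<epsilon> + integral {x..1} k"
      by simp
    then have "exp (?L x) \<le> exp (ln \<epsilon> + integral {x..1} k)"
      by simp
    then show ?thesis
      using pos[of x] that by (simp add: exp_add)
  qed
  have "E x \<le> 0"
  proof (rule tendsto_le[OF _ _ tendsto_const])
    show "((\<lambda>\<epsilon>. \<epsilon> * exp (integral {x..1} k)) \<longlongrightarrow> 0) (at_right 0)"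
      by (auto intro!: tendsto_eq_intros)
    show "\<forall>\<^sub>F \<epsilon> in at_right 0. E x \<le> \<epsilon> * exp (integral {x..1} k)"
      using le by (auto intro!: eventually_at_rightI[of 0 1] order_trans[OF _ le])
  qed simp
  then show ?thesis
    using sum_squares_le_zero_iff[of "u x" "D01 u x"] by (simp add: E_def)
qed

section \<open>The Sobolev space\<close>

lemma continuous_imp_L2:
  assumes "continuous_on {0..1} f"
  shows "L2 f"
  unfolding L2_def
proof
  show "f \<in> borel_measurable I01"
    using assms by (intro continuous_imp_measurable_on_sets_lebesgue) auto
  show "integrable I01 (\<lambda>x. (f x)\<^sup>2)"
    using assms by (intro continuous_imp_integrable_real continuous_intros)
qed

text \<open>The classical derivative is a weak derivative: test functions vanish at both endpoints, so that
integration by parts leaves no boundary terms.\<close>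

lemma C1_imp_H1:
  assumes f: "\<And>x. x \<in> {0..1} \<Longrightarrow> (f has_real_derivative f' x) (at x within {0..1})"
    and f': "continuous_on {0..1} f'"
  shows "H1 f"
proof -
  have cf: "continuous_on {0..1} f"
    using f by (intro DERIV_continuous_on)
  have "has_weak_deriv f f'"
    unfolding has_weak_deriv_def
  proof (intro allI impI)
    fix \<phi> assume \<phi>: "test_fun \<phi>"
    then have "\<phi> differentiable_on UNIV"
      unfolding test_fun_def by (metis funpow_0)
    then have d: "(\<phi> has_real_derivative deriv \<phi> x) (at x within {0..1})" for x
      by (metis DERIV_deriv_iff_real_differentiable UNIV_I differentiable_on_def has_field_derivative_at_within)
    have c: "continuous_on {0..1} \<phi>" "continuous_on {0..1} (deriv \<phi>)"
      using test_fun_continuous[OF \<phi>] by (auto intro: continuous_on_subset)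
    have "\<phi> 0 = 0" "\<phi> 1 = 0"
      using \<phi> unfolding test_fun_def by fastforce+
    moreover have "((\<lambda>x. f' x * \<phi> x + deriv \<phi> x * f x) has_integral f 1 * \<phi> 1 - f 0 * \<phi> 0) {0..1}"
      by (rule fundamental_theorem_of_calculus)
        (auto simp: has_real_derivative_iff_has_vector_derivative[symmetric] intro!: DERIV_mult f d)
    ultimately have "((\<lambda>x. f' x * \<phi> x + f x * deriv \<phi> x) has_integral 0) {0..1}"
      by (simp add: mult.commute)
    moreover have int: "integrable I01 (\<lambda>x. f' x * \<phi> x)" "integrable I01 (\<lambda>x. f x * deriv \<phi> x)"
      using cf f' c by (auto intro!: continuous_imp_integrable_real continuous_intros)
    then have "((\<lambda>x. f' x * \<phi> x + f x * deriv \<phi> x) has_integral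
        (LINT x|I01. f' x * \<phi> x) + (LINT x|I01. f x * deriv \<phi> x)) {0..1}"
      by (intro has_integral_add has_integral_integral_lebesgue_on) auto
    ultimately have "(LINT x|I01. f' x * \<phi> x) + (LINT x|I01. f x * deriv \<phi> x) = 0"
      using has_integral_unique by blast
    then show "(LINT x|I01. f x * deriv \<phi> x) = - (LINT x|I01. f' x * \<phi> x)"
      by linarith
  qed
  then show ?thesis
    unfolding H1_def using continuous_imp_L2[OF cf] continuous_imp_L2[OF f'] by blast
qed

lemma SL_solution_square_H1:
  assumes u: "SL_solution q \<mu> u"
  shows "H1 (\<lambda>x. (u x)\<^sup>2)"
proof (rule C1_imp_H1)
  show "((\<lambda>x. (u x)\<^sup>2) has_real_derivative 2 * u x * D01 u x) (at x within {0..1})"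
    if "x \<in> {0..1}" for x
    using DERIV_power[OF SL_solution_deriv[OF u that], of 2] by (simp add: mult_ac)
  show "continuous_on {0..1} (\<lambda>x. 2 * u x * D01 u x)"
    using abs_continuous01_continuous[OF SL_solution_abs_continuous[OF u]]
      abs_continuous01_continuous[OF SL_solution_abs_continuous_deriv[OF u]]
    by (intro continuous_intros)
qed

lemma continuous_AE_zero:
  assumes f: "continuous_on {0..1} f" and ae: "AE x in I01. f x = (0::real)" and x: "x \<in> {0..1}"
  shows "f x = 0"
proof -
  obtain N where N: "negligible N" "\<forall>x\<in>{0..1} - N. f x = 0"
    using ae unfolding AE_I01_negligible by blast
  have "\<not> negligible {0..1::real}"
    using negligible_interval(1)[of 0 "1::real"] by simp
  show ?thesis
  proof (rule ccontr)
    assume "f x \<noteq> 0"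
    then obtain \<delta> where \<delta>: "0 < \<delta>" "\<And>y. y \<in> {0..1} \<Longrightarrow> dist y x < \<delta> \<Longrightarrow> dist (f y) (f x) < \<bar>f x\<bar>"
      using f x unfolding continuous_on_iff by (metis zero_less_abs_iff)
    define a b where "a = max 0 (x - \<delta>)" and "b = min 1 (x + \<delta>)"
    have "a < b"
      using x \<delta>(1) by (auto simp: a_def b_def)
    have "{a<..<b} \<subseteq> N"
    proof
      fix y assume "y \<in> {a<..<b}"
      then have "y \<in> {0..1}" "dist y x < \<delta>"
        by (auto simp: a_def b_def dist_real_def)
      then have "f y \<noteq> 0"
        using \<delta>(2)[of y] by (auto simp: dist_real_def)
      then show "y \<in> N"
        using N(2) \<open>y \<in> {0..1}\<close> by blast
    qed
    then have "negligible {a<..<b}"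
      using N(1) negligible_subset by blast
    then show False
      using negligible_interval(2)[of a b] \<open>a < b\<close> by auto
  qed
qed

lemma h1_class_eq_zero_iff:
  assumes "H1 f"
  shows "h1_class f = 0 \<longleftrightarrow> (AE x in I01. f x = 0)"
proof -
  have "h1_class f = 0 \<longleftrightarrow> H1_eq f (\<lambda>x. 0)"
    unfolding zero_h1_def using Quotient3_rel[OF Quotient3_h1, of f "\<lambda>x. 0"] assms H1_zero
    by (auto simp: H1_eq_def)
  then show ?thesis
    using assms H1_zero by (simp add: H1_eq_def)
qed

text \<open>Arithmetic of classes is computed on representatives only for functions in the Sobolev space, so
the membership of the partial sums has to be carried through the induction.\<close>

lemma sum_h1_class:
  assumes "finite K" "\<And>k. k \<in> K \<Longrightarrow> H1 (f k)"
  shows "H1 (\<lambda>x. \<Sum>k\<in>K. c k * f k x) \<and>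
    (\<Sum>k\<in>K. c k *\<^sub>R h1_class (f k)) = h1_class (\<lambda>x. \<Sum>k\<in>K. c k * f k x)"
  using assms
proof (induction K rule: finite_induct)
  case empty
  show ?case
    using H1_zero by (simp add: zero_h1_def)
next
  case (insert k K)
  let ?s = "\<lambda>x. \<Sum>k\<in>K. c k * f k x"
  have s: "H1 ?s" "(\<Sum>k\<in>K. c k *\<^sub>R h1_class (f k)) = h1_class ?s" and k: "H1 (f k)"
    using insert by auto
  have "c k *\<^sub>R h1_class (f k) = h1_class (\<lambda>x. c k * f k x)"
    using k by (intro scaleR_h1.abs_eq) (simp add: H1_eq_def)
  moreover have "h1_class (\<lambda>x. c k * f k x) + h1_class ?s = h1_class (\<lambda>x. c k * f k x + ?s x)"
    using H1_scale[OF k] s(1) by (intro plus_h1.abs_eq) (simp_all add: H1_eq_def)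
  ultimately show ?case
    using insert.hyps s(2) H1_add[OF H1_scale[OF k] s(1)] by simp
qed

section \<open>Vanishing of the coefficients\<close>

text \<open>Multiplying by all denominators turns the sum into a polynomial that vanishes on the infinite set
\<open>Z\<close>, hence everywhere; its value at the pole \<open>p m\<close> is \<open>c m\<close> times a nonzero product.\<close>

lemma partial_fractions_zero:
  fixes c p :: "'b \<Rightarrow> real"
  assumes fin: "finite B" and inj: "inj_on p B" and Z: "infinite Z" "Z \<inter> p ` B = {}"
    and zero: "\<And>z. z \<in> Z \<Longrightarrow> (\<Sum>m\<in>B. c m / (p m - z)) = 0"
    and m: "m \<in> B"
  shows "c m = 0"
proof -
  define P where "P = (\<Sum>m\<in>B. smult (c m) (\<Prod>j\<in>B - {m}. [:p j, -1:]))"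
  have P: "poly P z = (\<Sum>m\<in>B. c m * (\<Prod>j\<in>B - {m}. p j - z))" for z
    by (simp add: P_def poly_sum poly_prod)
  have "poly P z = 0" if "z \<in> Z" for z
  proof -
    have nz: "p j - z \<noteq> 0" if "j \<in> B" for j
      using Z(2) \<open>z \<in> Z\<close> that by auto
    have "poly P z = (\<Sum>m\<in>B. (\<Prod>j\<in>B. p j - z) * (c m / (p m - z)))"
      unfolding P
    proof (rule sum.cong[OF refl])
      fix m assume "m \<in> B"
      then have "(\<Prod>j\<in>B. p j - z) = (p m - z) * (\<Prod>j\<in>B - {m}. p j - z)"
        using fin by (simp add: prod.remove)
      then show "c m * (\<Prod>j\<in>B - {m}. p j - z) = (\<Prod>j\<in>B. p j - z) * (c m / (p m - z))"
        using nz[OF \<open>m \<in> B\<close>] by simp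
    qed
    also have "\<dots> = 0"
      unfolding sum_distrib_left[symmetric] zero[OF that] by simp
    finally show ?thesis .
  qed
  then have "infinite {z. poly P z = 0}"
    using Z(1) by (meson finite_subset mem_Collect_eq subsetI)
  then have "P = 0"
    using poly_roots_finite by blast
  then have "0 = (\<Sum>n\<in>B. c n * (\<Prod>j\<in>B - {n}. p j - p m))"
    using P[of "p m"] by simp
  also have "\<dots> = (\<Sum>n\<in>{m}. c n * (\<Prod>j\<in>B - {n}. p j - p m))"
  proof (rule sum.mono_neutral_right[OF fin])
    show "\<forall>n\<in>B - {m}. c n * (\<Prod>j\<in>B - {n}. p j - p m) = 0"
    proof
      fix n assume "n \<in> B - {m}"
      then have "m \<in> B - {n}"
        using m by auto
      then have "(\<Prod>j\<in>B - {n}. p j - p m) = 0"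
        using fin by (intro prod_zero) auto
      then show "c n * (\<Prod>j\<in>B - {n}. p j - p m) = 0"
        by simp
    qed
  qed (use m in auto)
  finally have "c m * (\<Prod>j\<in>B - {m}. p j - p m) = 0"
    by simp
  moreover have "(\<Prod>j\<in>B - {m}. p j - p m) \<noteq> 0"
    using fin inj m by (auto simp: inj_on_def)
  ultimately show ?thesis
    by simp
qed

lemma eq_zero_on_unit_interval_imp_deriv_zero:
  assumes f: "(f has_real_derivative D) (at x within {0..1})" and x: "x \<in> {0..1}"
    and zero: "\<And>y. y \<in> {0..1} \<Longrightarrow> f y = 0"
  shows "D = 0"
proof -
  have "((\<lambda>y. 0) has_real_derivative D) (at x within {0..1})"
    by (rule has_field_derivative_transform_within[OF f, of 1]) (use x zero in auto)
  then show ?thesis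
    using vector_derivative_unique_within_closed_interval[of 0 1 x "\<lambda>y. 0" D 0] x
    by (simp add: has_real_derivative_iff_has_vector_derivative)
qed

text \<open>The derivative of the sum is the combination \<open>F (v\<^sup>2)' - F' v\<^sup>2\<close>, where \<open>F\<close> is the left-hand side of
the relation \<open>rel\<close>. Both \<open>F\<close> and \<open>F'\<close> vanish, and the sum is zero at \<open>0\<close>.\<close>

lemma wronskian_square_relation:
  assumes fin: "finite K"
    and u: "\<And>k. k \<in> K \<Longrightarrow> SL_solution q (\<Lambda> k) (u k)" and v: "SL_solution q \<mu> v"
    and rel: "\<And>x. x \<in> {0..1} \<Longrightarrow> (\<Sum>k\<in>K. c k * (u k x)\<^sup>2) = 0"
    and \<mu>: "\<mu> \<notin> \<Lambda> ` K"
    and W0: "\<And>k. k \<in> K \<Longrightarrow> wronskian (u k) v 0 = 0"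
  shows "(\<Sum>k\<in>K. c k * (wronskian (u k) v 1)\<^sup>2 / (\<Lambda> k - \<mu>)) = 0"
proof -
  define R where "R x = (\<Sum>k\<in>K. c k * (wronskian (u k) v x)\<^sup>2 / (\<Lambda> k - \<mu>))" for x
  have R': "(R has_real_derivative 0) (at x within {0..1})" if x: "x \<in> {0..1}" for x
  proof -
    have "(R has_real_derivative (\<Sum>k\<in>K. c k * (2 * wronskian (u k) v x * (u k x * v x)))) (at x within {0..1})"
      unfolding R_def[abs_def]
    proof (rule DERIV_sum)
      fix k assume k: "k \<in> K"
      then have "\<Lambda> k - \<mu> \<noteq> 0"
        using \<mu> by auto
      have "((\<lambda>y. (wronskian (u k) v y)\<^sup>2) has_real_derivative
          2 * wronskian (u k) v x * ((\<Lambda> k - \<mu>) * (u k x * v x))) (at x within {0..1})"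
        using DERIV_power[OF wronskian_deriv[OF u[OF k] v x], of 2] by (simp add: mult_ac)
      from DERIV_cmult[OF this, of "c k / (\<Lambda> k - \<mu>)"]
      show "((\<lambda>y. c k * (wronskian (u k) v y)\<^sup>2 / (\<Lambda> k - \<mu>)) has_real_derivative
          c k * (2 * wronskian (u k) v x * (u k x * v x))) (at x within {0..1})"
        using \<open>\<Lambda> k - \<mu> \<noteq> 0\<close> by (simp add: mult_ac)
    qed
    moreover have "((\<lambda>y. \<Sum>k\<in>K. c k * (u k y)\<^sup>2) has_real_derivative
        (\<Sum>k\<in>K. c k * (2 * u k x * D01 (u k) x))) (at x within {0..1})"
    proof (rule DERIV_sum)
      fix k assume k: "k \<in> K"
      show "((\<lambda>y. c k * (u k y)\<^sup>2) has_real_derivative c k * (2 * u k x * D01 (u k) x)) (at x within {0..1})"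
        using DERIV_cmult[OF DERIV_power[OF SL_solution_deriv[OF u[OF k] x], of 2], of "c k"]
        by (simp add: mult_ac)
    qed
    then have "(\<Sum>k\<in>K. c k * (2 * u k x * D01 (u k) x)) = 0"
      by (rule eq_zero_on_unit_interval_imp_deriv_zero) (use x rel in auto)
    moreover have "(\<Sum>k\<in>K. c k * (2 * wronskian (u k) v x * (u k x * v x))) =
        2 * v x * D01 v x * (\<Sum>k\<in>K. c k * (u k x)\<^sup>2) - (v x)\<^sup>2 * (\<Sum>k\<in>K. c k * (2 * u k x * D01 (u k) x))"
      unfolding sum_distrib_left sum_subtractf[symmetric]
      by (intro sum.cong) (auto simp: wronskian_def power2_eq_square algebra_simps)
    ultimately show ?thesis
      using rel[OF x] by simp
  qed
  have "R 1 = R 0"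
    using has_field_derivative_zero_constant[of "{0..1}" R] R' by force
  also have "R 0 = 0"
    using W0 by (simp add: R_def)
  finally show ?thesis
    by (simp add: R_def)
qed

text \<open>A vector orthogonal to the unit vector \<open>(cos \<theta>, sin \<theta>)\<close> is a multiple of \<open>(- sin \<theta>, cos \<theta>)\<close>. This
form of the boundary conditions makes the Wronskian at an endpoint a product.\<close>

lemma boundary_condition_param:
  fixes s t \<theta> :: real
  assumes "s * cos \<theta> + t * sin \<theta> = 0"
  obtains A where "s = - A * sin \<theta>" "t = A * cos \<theta>"
proof
  have "t * sin \<theta> = - s * cos \<theta>"
    using assms by linarith
  then have "t * sin \<theta> * sin \<theta> = - s * cos \<theta> * sin \<theta>" "t * sin \<theta> * cos \<theta> = - s * cos \<theta> * cos \<theta>"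
    by simp_all
  then show "s = - (t * cos \<theta> - s * sin \<theta>) * sin \<theta>" "t = (t * cos \<theta> - s * sin \<theta>) * cos \<theta>"
    using sin_cos_squared_add3[of \<theta>] by algebra+
qed

lemma eigenfunction_end_value:
  assumes "L2 q" and u: "SL_eigenfunction q \<alpha> \<beta> \<mu> u"
  obtains B where "B \<noteq> 0" "u 1 = - B * sin \<beta>" "D01 u 1 = B * cos \<beta>"
proof -
  have "u 1 * cos \<beta> + D01 u 1 * sin \<beta> = 0"
    using u unfolding SL_eigenfunction_def SL_bc_def by blast
  then obtain B where B: "u 1 = - B * sin \<beta>" "D01 u 1 = B * cos \<beta>"
    by (rule boundary_condition_param)
  moreover have "B \<noteq> 0"
    using SL_solution_unique[OF \<open>L2 q\<close>] u B unfolding SL_eigenfunction_def by fastforce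
  ultimately show ?thesis
    using that by blast
qed

lemma wronskian_same_boundary_condition:
  assumes "u x * cos \<theta> + D01 u x * sin \<theta> = 0" "v x * cos \<theta> + D01 v x * sin \<theta> = 0"
  shows "wronskian u v x = 0"
proof -
  obtain A where "u x = - A * sin \<theta>" "D01 u x = A * cos \<theta>"
    using assms(1) by (rule boundary_condition_param)
  moreover obtain B where "v x = - B * sin \<theta>" "D01 v x = B * cos \<theta>"
    using assms(2) by (rule boundary_condition_param)
  ultimately show ?thesis
    by (simp add: wronskian_def)
qed

text \<open>The set \<open>J\<close> collects the members \<open>u k\<close> of the relation that belong to the problem \<open>(\<alpha>\<gamma>)\<close>; the others
belong to \<open>(\<alpha>\<beta>)\<close>. Eigenfunctions \<open>v\<close> of \<open>(\<alpha>\<beta>)\<close> make the others invisible at the endpoint \<open>1\<close>,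
and for \<open>k \<in> J\<close> the squared Wronskian there is a product of a factor depending on \<open>k\<close> and
a factor depending on \<open>v\<close>. The second factor cancels, which leaves a rational function of the
eigenvalue of \<open>v\<close>.\<close>

lemma coefficients_of_one_problem_vanish:
  assumes q: "L2 q" and s: "sin (\<beta> - \<gamma>) \<noteq> 0" and fin: "finite K"
    and J: "J \<subseteq> K" "inj_on \<Lambda> J"
    and u\<gamma>: "\<And>k. k \<in> J \<Longrightarrow> SL_eigenfunction q \<alpha> \<gamma> (\<Lambda> k) (u k)"
    and u\<beta>: "\<And>k. k \<in> K - J \<Longrightarrow> SL_eigenfunction q \<alpha> \<beta> (\<Lambda> k) (u k)"
    and inf: "infinite (SL_eigenvalues q \<alpha> \<beta>)"
    and rel: "\<And>x. x \<in> {0..1} \<Longrightarrow> (\<Sum>k\<in>K. c k * (u k x)\<^sup>2) = 0"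
    and m: "m \<in> J"
  shows "c m = 0"
proof -
  have "\<forall>k\<in>J. \<exists>A. A \<noteq> 0 \<and> u k 1 = - A * sin \<gamma> \<and> D01 (u k) 1 = A * cos \<gamma>"
    using eigenfunction_end_value[OF q u\<gamma>] by metis
  then obtain A where A: "\<And>k. k \<in> J \<Longrightarrow> A k \<noteq> 0 \<and> u k 1 = - A k * sin \<gamma> \<and> D01 (u k) 1 = A k * cos \<gamma>"
    by metis
  have u: "SL_solution q (\<Lambda> k) (u k)" "u k 0 * cos \<alpha> + D01 (u k) 0 * sin \<alpha> = 0" if "k \<in> K" for k
    using u\<beta>[of k] u\<gamma>[of k] that unfolding SL_eigenfunction_def SL_bc_def by blast+
  have "c m * (A m)\<^sup>2 = 0"
  proof (rule partial_fractions_zero[where p = \<Lambda> and c = "\<lambda>k. c k * (A k)\<^sup>2" and B = J])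
    show "finite J"
      using J fin finite_subset by blast
    show "infinite (SL_eigenvalues q \<alpha> \<beta> - \<Lambda> ` K)"
      using inf fin by simp
    show "(SL_eigenvalues q \<alpha> \<beta> - \<Lambda> ` K) \<inter> \<Lambda> ` J = {}"
      using J by blast
    fix \<mu> assume "\<mu> \<in> SL_eigenvalues q \<alpha> \<beta> - \<Lambda> ` K"
    then obtain v where v: "SL_eigenfunction q \<alpha> \<beta> \<mu> v" and \<mu>: "\<mu> \<notin> \<Lambda> ` K"
      unfolding SL_eigenvalues_def by blast
    obtain B where B: "B \<noteq> 0" "v 1 = - B * sin \<beta>" "D01 v 1 = B * cos \<beta>"
      using eigenfunction_end_value[OF q v] by blast
    have "(\<Sum>k\<in>K. c k * (wronskian (u k) v 1)\<^sup>2 / (\<Lambda> k - \<mu>)) = 0"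
    proof (rule wronskian_square_relation[OF fin u(1) _ rel \<mu>])
      show "SL_solution q \<mu> v"
        using v unfolding SL_eigenfunction_def by blast
      show "wronskian (u k) v 0 = 0" if "k \<in> K" for k
        using u(2)[OF that] v unfolding SL_eigenfunction_def SL_bc_def
        by (intro wronskian_same_boundary_condition[where \<theta> = \<alpha>]) auto
    qed
    also have "(\<Sum>k\<in>K. c k * (wronskian (u k) v 1)\<^sup>2 / (\<Lambda> k - \<mu>)) =
        (\<Sum>k\<in>J. c k * (wronskian (u k) v 1)\<^sup>2 / (\<Lambda> k - \<mu>))"
    proof (rule sum.mono_neutral_right[OF fin J(1)], rule ballI)
      fix k assume "k \<in> K - J"
      then have "wronskian (u k) v 1 = 0"
        using u\<beta>[of k] v unfolding SL_eigenfunction_def SL_bc_def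
        by (intro wronskian_same_boundary_condition[where \<theta> = \<beta>]) auto
      then show "c k * (wronskian (u k) v 1)\<^sup>2 / (\<Lambda> k - \<mu>) = 0"
        by simp
    qed
    also have "\<dots> = (\<Sum>k\<in>J. (B * sin (\<beta> - \<gamma>))\<^sup>2 * (c k * (A k)\<^sup>2 / (\<Lambda> k - \<mu>)))"
    proof (rule sum.cong[OF refl])
      fix k assume "k \<in> J"
      then have "wronskian (u k) v 1 = A k * (B * sin (\<beta> - \<gamma>))"
        using A[of k] B by (simp add: wronskian_def sin_diff algebra_simps)
      then show "c k * (wronskian (u k) v 1)\<^sup>2 / (\<Lambda> k - \<mu>) =
          (B * sin (\<beta> - \<gamma>))\<^sup>2 * (c k * (A k)\<^sup>2 / (\<Lambda> k - \<mu>))"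
        by (simp add: power_mult_distrib)
    qed
    finally show "(\<Sum>k\<in>J. c k * (A k)\<^sup>2 / (\<Lambda> k - \<mu>)) = 0"
      using B(1) s unfolding sum_distrib_left[symmetric] by simp
  qed (use J m in auto)
  then show ?thesis
    using A[OF m] by simp
qed

section \<open>Linear independence of the squared eigenfunctions\<close>

lemma independent_family:
  fixes G :: "'i \<Rightarrow> 'a::real_vector"
  assumes G: "\<And>K c k. finite K \<Longrightarrow> K \<subseteq> I \<Longrightarrow> (\<Sum>k\<in>K. c k *\<^sub>R G k) = 0 \<Longrightarrow> k \<in> K \<Longrightarrow> c k = 0"
  shows "inj_on G I \<and> independent (G ` I)"
proof
  show "inj_on G I"
  proof (rule inj_onI, rule ccontr)
    fix a b assume ab: "a \<in> I" "b \<in> I" "G a = G b" "a \<noteq> b"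
    then have "(\<Sum>k\<in>{a, b}. (if k = a then 1 else -1) *\<^sub>R G k) = 0"
      by simp
    from G[OF _ _ this, of a] ab show False
      by simp
  qed
  show "independent (G ` I)"
    unfolding real_vector.independent_explicit_finite_subsets
  proof (intro allI impI ballI)
    fix S c w assume S: "S \<subseteq> G ` I" "finite S" "(\<Sum>v\<in>S. c v *\<^sub>R v) = 0" "w \<in> S"
    obtain K where K: "K \<subseteq> I" "finite K" "inj_on G K" "S = G ` K"
      using S(1,2) by (metis finite_image_iff subset_image_inj)
    then have "(\<Sum>k\<in>K. c (G k) *\<^sub>R G k) = 0"
      using S(3) by (simp add: sum.reindex)
    then show "c w = 0"
      using G[of K "\<lambda>k. c (G k)"] K S(4) by auto
  qed
qed

theorem theorem5p2:
  fixes q :: "real \<Rightarrow> real" and \<alpha> \<beta> \<gamma> :: real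
    and l :: "nat \<Rightarrow> nat \<Rightarrow> real" and g :: "nat \<Rightarrow> nat \<Rightarrow> real \<Rightarrow> real"
  assumes "L2 q"
    and "sin (\<beta> - \<gamma>) \<noteq> 0"
    and "SL_eigensystem q \<alpha> \<beta> (l 1) (g 1)"
    and "SL_eigensystem q \<alpha> \<gamma> (l 2) (g 2)"
  defines "G \<equiv> \<lambda>(i, n). h1_class (\<lambda>x. (g i n x)\<^sup>2)"
  shows "(\<forall>i\<in>{1, 2}. \<forall>n. H1 (\<lambda>x. (g i n x)\<^sup>2)) \<and>
    inj_on G ({1, 2} \<times> UNIV) \<and> independent (G ` ({1, 2} \<times> UNIV))"
proof -
  define I where "I = {1, 2::nat} \<times> (UNIV :: nat set)"
  define \<Lambda> where "\<Lambda> = (\<lambda>(i, n). l i n)"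
  define u where "u = (\<lambda>(i, n). g i n)"
  have ef1: "SL_eigenfunction q \<alpha> \<beta> (l 1 n) (g 1 n)" for n
    using assms(3) unfolding SL_eigensystem_def by blast
  have ef2: "SL_eigenfunction q \<alpha> \<gamma> (l 2 n) (g 2 n)" for n
    using assms(4) unfolding SL_eigensystem_def by blast
  have inj: "inj (l 1)" "inj (l 2)"
    using assms(3,4) unfolding SL_eigensystem_def by (auto intro: strict_mono_imp_inj_on)
  then have inf: "infinite (SL_eigenvalues q \<alpha> \<beta>)" "infinite (SL_eigenvalues q \<alpha> \<gamma>)"
    using assms(3,4) unfolding SL_eigensystem_def by (metis infinite_UNIV_nat finite_imageD)+
  have sol: "SL_solution q (\<Lambda> k) (u k)" if "k \<in> I" for k
    using that ef1 ef2 unfolding I_def \<Lambda>_def u_def SL_eigenfunction_def by auto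
  have H1: "H1 (\<lambda>x. (u k x)\<^sup>2)" if "k \<in> I" for k
    using SL_solution_square_H1[OF sol[OF that]] .
  have G: "G k = h1_class (\<lambda>x. (u k x)\<^sup>2)" for k
    by (simp add: G_def u_def split: prod.split)
  have "c k = 0" if fin: "finite K" and KI: "K \<subseteq> I" and dep: "(\<Sum>k\<in>K. c k *\<^sub>R G k) = 0" and k: "k \<in> K"
    for K c k
  proof -
    let ?f = "\<lambda>x. \<Sum>k\<in>K. c k * (u k x)\<^sup>2"
    have "H1 ?f \<and> h1_class ?f = 0"
      using sum_h1_class[of K "\<lambda>k x. (u k x)\<^sup>2" c] fin KI H1 dep by (auto simp: G)
    then have "AE x in I01. ?f x = 0"
      using h1_class_eq_zero_iff by blast
    moreover have "continuous_on {0..1} ?f"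
      using abs_continuous01_continuous[OF SL_solution_abs_continuous[OF sol]] KI
      by (intro continuous_intros) auto
    ultimately have rel: "?f x = 0" if "x \<in> {0..1}" for x
      using continuous_AE_zero that by blast
    define J where "J i = K \<inter> {i} \<times> UNIV" for i
    have J: "J i \<subseteq> K" for i
      unfolding J_def by blast
    have \<Lambda>J: "inj_on \<Lambda> (J 1)" "inj_on \<Lambda> (J 2)"
      using inj unfolding J_def \<Lambda>_def inj_on_def by auto
    have KJ: "K - J 1 \<subseteq> J 2" "K - J 2 \<subseteq> J 1"
      using KI unfolding J_def I_def by auto
    have e: "SL_eigenfunction q \<alpha> \<beta> (\<Lambda> k) (u k)" if "k \<in> J 1" for k
      using that ef1 unfolding J_def \<Lambda>_def u_def by auto
    have e': "SL_eigenfunction q \<alpha> \<gamma> (\<Lambda> k) (u k)" if "k \<in> J 2" for k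
      using that ef2 unfolding J_def \<Lambda>_def u_def by auto
    have s: "sin (\<gamma> - \<beta>) \<noteq> 0"
      using assms(2) sin_minus[of "\<beta> - \<gamma>"] by simp
    have "c k = 0" if "k \<in> J 2"
      by (rule coefficients_of_one_problem_vanish[OF assms(1,2) fin J \<Lambda>J(2) e' _ inf(1) rel that])
        (use e KJ in auto)
    moreover have "c k = 0" if "k \<in> J 1"
      by (rule coefficients_of_one_problem_vanish[OF assms(1) s fin J \<Lambda>J(1) e _ inf(2) rel that])
        (use e' KJ in auto)
    ultimately show ?thesis
      using k KJ by blast
  qed
  then have "inj_on G I \<and> independent (G ` I)"
    by (rule independent_family)
  moreover have "\<forall>i\<in>{1, 2}. \<forall>n. H1 (\<lambda>x. (g i n x)\<^sup>2)"
    using H1 unfolding I_def u_def by auto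
  ultimately show ?thesis
    unfolding I_def by blast
qed

end
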